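(* Let $\mathbb{F}$ be an algebraically closed field and let $X \subset \mathbb{F}\mathbb{P}^n$ be an irreducible nondegenerate projective variety. Let $r_{\mathrm{max}}$ be the maximum value of rank with respect to $X$ and let $r_{\mathrm{gen}}$ be the generic value of rank with respect to $X$. Then $$r_{\mathrm{max}} \leq 2\, r_{\mathrm{gen}}.$$
   Context: Let $\hat{X} \subset \mathbb{F}^{n+1}$ be the affine cone over $X \subset \mathbb{F}\mathbb{P}^n$. The variety $X$ is nondegenerate if $X$ (equivalently $\hat X$) is not contained in a hyperplane. For a nonzero vector $v \in \mathbb{F}^{n+1}$, the rank of $v$ with respect to $X$ (the $X$-rank of $v$) is $$\operatorname{rank}_X(v) = \min\Big\{ r : v = \sum_{i=1}^r x_i \text{ with } x_i \in \hat X \Big\}.$$ The maximum rank $r_{\mathrm{max}}$ is the maximum of $\operatorname{rank}_X(v)$ over nonzero $v \in \mathbb{F}^{n+1}$. A rank $r$ is called generic if the set of vectors of $X$-rank equal to $r$ contains a nonempty Zariski open subset of $\mathbb{F}^{n+1}$; over an algebraically closed field a nondegenerate irreducible variety $X$ has a unique generic rank, denoted $r_{\mathrm{gen}}$. *)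

theory Defs
  imports "HOL-Analysis.Analysis" "HOL-Library.Poly_Mapping" "HOL-Library.Extended_Nat"
    "HOL-Computational_Algebra.Polynomial"
begin

text \<open>
  The space \<open>\<bbbF>\<^sup>n\<^sup>+\<^sup>1\<close> is the type \<open>'a ^ 'n\<close> with \<open>CARD('n) = n + 1\<close>.  A polynomial in the
  coordinates is a finitely supported map from monomials (exponent vectors) to coefficients.
\<close>

type_synonym ('a, 'n) mpol = "('n \<Rightarrow>\<^sub>0 nat) \<Rightarrow>\<^sub>0 'a"

definition eval_mpol :: "('a::field, 'n::finite) mpol \<Rightarrow> 'a ^ 'n \<Rightarrow> 'a" where
  "eval_mpol p v =
     (\<Sum>m\<in>Poly_Mapping.keys p.
        Poly_Mapping.lookup p m * (\<Prod>i\<in>UNIV. (v $ i) ^ Poly_Mapping.lookup m i))"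

definition homogeneous :: "('a::field, 'n::finite) mpol \<Rightarrow> bool" where
  "homogeneous p \<longleftrightarrow>
     (\<exists>d. \<forall>m\<in>Poly_Mapping.keys p. (\<Sum>i\<in>UNIV. Poly_Mapping.lookup m i) = d)"

definition zariski_closed :: "('a::field ^ 'n::finite) set \<Rightarrow> bool" where
  "zariski_closed Z \<longleftrightarrow>
     (\<exists>S :: ('a, 'n) mpol set. Z = {v. \<forall>p\<in>S. eval_mpol p v = 0})"

definition zariski_open :: "('a::field ^ 'n::finite) set \<Rightarrow> bool" where
  "zariski_open U \<longleftrightarrow> zariski_closed (- U)"

text \<open>Points of \<open>\<bbbF>\<bbbP>\<^sup>n\<close> are the lines through the origin of \<open>\<bbbF>\<^sup>n\<^sup>+\<^sup>1\<close>.\<close>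

definition proj_space :: "('a::field ^ 'n::finite) set set" where
  "proj_space = {vec.span {v} | v. v \<noteq> 0}"

definition proj_closed :: "('a::field ^ 'n::finite) set set \<Rightarrow> bool" where
  "proj_closed X \<longleftrightarrow>
     (\<exists>S :: ('a, 'n) mpol set. (\<forall>p\<in>S. homogeneous p) \<and>
        X = {L \<in> proj_space. \<forall>p\<in>S. \<forall>v\<in>L - {0}. eval_mpol p v = 0})"

definition irreducible_proj_variety :: "('a::field ^ 'n::finite) set set \<Rightarrow> bool" where
  "irreducible_proj_variety X \<longleftrightarrow> proj_closed X \<and> X \<noteq> {} \<and>
     (\<forall>A B. proj_closed A \<longrightarrow> proj_closed B \<longrightarrow> X = A \<union> B \<longrightarrow> X = A \<or> X = B)"

definition affine_cone :: "('a::field ^ 'n::finite) set set \<Rightarrow> ('a ^ 'n) set" where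
  "affine_cone X = insert 0 (\<Union>X)"

definition hyperplane :: "('a::field ^ 'n::finite) set \<Rightarrow> bool" where
  "hyperplane H \<longleftrightarrow> (\<exists>a. a \<noteq> 0 \<and> H = {v. (\<Sum>i\<in>UNIV. a $ i * v $ i) = 0})"

definition nondegenerate :: "('a::field ^ 'n::finite) set set \<Rightarrow> bool" where
  "nondegenerate X \<longleftrightarrow> \<not> (\<exists>H. hyperplane H \<and> affine_cone X \<subseteq> H)"

text \<open>
  The rank is an extended natural number, so that it is \<open>\<infinity>\<close> (the infimum of the empty set) for a
  vector that is not a finite sum of elements of the cone; otherwise the infimum is a minimum.
\<close>

definition X_rank :: "('a::field ^ 'n::finite) set set \<Rightarrow> 'a ^ 'n \<Rightarrow> enat" where
  "X_rank X v =
     Inf {enat r | r. \<exists>x. (\<forall>i\<in>{1..r}. x i \<in> affine_cone X) \<and> v = (\<Sum>i=1..r. x i)}"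

text \<open>
  Likewise, a finite supremum of a nonempty set of extended naturals is attained, so whenever the
  ranks are bounded the following is their maximum; otherwise it is \<open>\<infinity>\<close>.
\<close>

definition max_rank :: "('a::field ^ 'n::finite) set set \<Rightarrow> enat" where
  "max_rank X = Sup {X_rank X v | v. v \<noteq> 0}"

definition generic_rank :: "('a::field ^ 'n::finite) set set \<Rightarrow> nat \<Rightarrow> bool" where
  "generic_rank X r \<longleftrightarrow>
     (\<exists>U. zariski_open U \<and> U \<noteq> {} \<and> U \<subseteq> {v. v \<noteq> 0 \<and> X_rank X v = enat r})"

end

theory Submission
  imports Defs
begin

text \<open>
  For a target \<open>w\<close> and a nonempty open \<open>U\<close> of vectors of rank \<open>r\<close>, it suffices to find \<open>u \<in> U\<close>
  with \<open>w - u \<in> U\<close>.  Pick \<open>u\<^sub>0 \<in> U\<close> and restrict to the line through \<open>u\<^sub>0\<close> and \<open>w - u\<^sub>0\<close>: a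
  polynomial that is nonzero at \<open>u\<^sub>0\<close> and vanishes off \<open>U\<close> excludes only finitely many points of
  this line, both for \<open>u\<close> and for \<open>w - u\<close>, and the ground field is infinite.
\<close>

text \<open>Over a finite field the product of all \<open>[:- a, 1:]\<close> vanishes everywhere, so
  adding 1 gives a polynomial of positive degree without roots.\<close>

lemma infinite_UNIV_alg_closed_field: "infinite (UNIV :: 'a::alg_closed_field set)"
proof
  assume fin: "finite (UNIV :: 'a set)"
  define p :: "'a poly" where "p = (\<Prod>a\<in>UNIV. [:- a, 1:])"
  have "degree p = card (UNIV :: 'a set)"
    unfolding p_def by (subst degree_prod_eq_sum_degree) auto
  then have "degree (p + 1) > 0"
    using fin by (subst degree_add_eq_left) (simp_all add: card_gt_0_iff)
  then obtain x where "poly (p + 1) x = 0"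
    using alg_closed_imp_poly_has_root by blast
  moreover have "poly p x = 0"
    using fin by (auto simp: p_def poly_prod prod_zero_iff)
  ultimately show False
    by simp
qed

text \<open>Along a line every coordinate is a polynomial in \<open>t\<close> of degree at most 1,
  so zeros on the line become roots of a univariate polynomial.\<close>

lemma eval_mpol_line:
  fixes p :: "('a::field, 'n::finite) mpol"
  obtains q where "\<And>t. eval_mpol p (a + t *s b) = poly q t"
proof
  show "eval_mpol p (a + t *s b) = poly (\<Sum>m\<in>Poly_Mapping.keys p.
      [:Poly_Mapping.lookup p m:] * (\<Prod>i\<in>UNIV. [:a $ i, b $ i:] ^ Poly_Mapping.lookup m i)) t" for t
    by (simp add: eval_mpol_def poly_sum poly_prod poly_power)
qed

lemma zariski_open_meets_reflection:
  fixes U :: "('a::field ^ 'n::finite) set"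
  assumes inf: "infinite (UNIV :: 'a set)" and "zariski_open U" and "U \<noteq> {}"
  obtains u where "u \<in> U" and "w - u \<in> U"
proof -
  from \<open>zariski_open U\<close> obtain S :: "('a, 'n) mpol set"
    where S: "- U = {v. \<forall>p\<in>S. eval_mpol p v = 0}"
    by (auto simp: zariski_open_def zariski_closed_def)
  from \<open>U \<noteq> {}\<close> obtain u0 where "u0 \<in> U"
    by blast
  with S obtain p where "p \<in> S" and p: "eval_mpol p u0 \<noteq> 0"
    by blast
  with S have U: "v \<in> U" if "eval_mpol p v \<noteq> 0" for v
    using that by blast
  \<comment> \<open>With this direction, \<open>u0 + t *s d\<close> is \<open>u0\<close> at
    \<open>t = 0\<close> and \<open>w - u0\<close> at \<open>t = 1\<close>. Its reflection
    \<open>w - (u0 + t *s d)\<close>, described by \<open>g\<close>, reaches \<open>u0\<close> at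
    \<open>t = 1\<close>; hence neither \<open>f\<close> nor \<open>g\<close> is zero.\<close>
  define d where "d = w - u0 - u0"
  obtain f where f: "\<And>t. eval_mpol p (u0 + t *s d) = poly f t"
    using eval_mpol_line by blast
  obtain g where g: "\<And>t. eval_mpol p ((w - u0) + t *s (- d)) = poly g t"
    using eval_mpol_line by blast
  have "poly f 0 \<noteq> 0"
    using p f[of 0] by simp
  moreover have "poly g 1 \<noteq> 0"
    using p g[of 1] by (simp add: d_def)
  ultimately have "f * g \<noteq> 0"
    by auto
  then have "finite {t. poly (f * g) t = 0}"
    by (rule poly_roots_finite)
  then have "{t. poly (f * g) t = 0} \<noteq> UNIV"
    using inf by metis
  then obtain t where "poly (f * g) t \<noteq> 0"
    by blast
  then have "eval_mpol p (u0 + t *s d) \<noteq> 0" and "eval_mpol p (w - (u0 + t *s d)) \<noteq> 0"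
    using f[of t] g[of t] by (simp_all add: algebra_simps)
  then show ?thesis
    using U that by blast
qed

lemma X_rank_le:
  assumes "\<forall>i\<in>{1..r}. x i \<in> affine_cone X" and "v = (\<Sum>i=1..r. x i)"
  shows "X_rank X v \<le> enat r"
  unfolding X_rank_def using assms by (intro Inf_lower) blast

lemma X_rank_eq_enatE:
  assumes "X_rank X v = enat r"
  obtains x where "\<forall>i\<in>{1..r}. x i \<in> affine_cone X" and "v = (\<Sum>i=1..r. x i)"
proof -
  let ?R = "{enat r | r. \<exists>x. (\<forall>i\<in>{1..r}. x i \<in> affine_cone X) \<and> v = (\<Sum>i=1..r. x i)}"
  have "Inf ?R = enat r"
    using assms by (simp only: X_rank_def)
  \<comment> \<open>The infimum is finite, so \<open>?R\<close> is nonempty, and a nonempty set of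
    extended naturals attains its infimum.\<close>
  moreover from this have "Inf ?R \<in> ?R"
    by (metis (no_types, lifting) Inf_enat_def LeastI enat.distinct(1) ex_in_conv)
  ultimately show ?thesis
    using that by auto
qed

lemma X_rank_add_le: "X_rank X (u + v) \<le> X_rank X u + X_rank X v"
proof (cases "X_rank X u"; cases "X_rank X v")
  fix r s assume r: "X_rank X u = enat r" and s: "X_rank X v = enat s"
  obtain x where x: "\<forall>i\<in>{1..r}. x i \<in> affine_cone X" "u = (\<Sum>i=1..r. x i)"
    using r by (rule X_rank_eq_enatE)
  obtain y where y: "\<forall>i\<in>{1..s}. y i \<in> affine_cone X" "v = (\<Sum>i=1..s. y i)"
    using s by (rule X_rank_eq_enatE)
  \<comment> \<open>Concatenation of the two decompositions; an infinite rank on either side makes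
    the bound trivial.\<close>
  define z where "z i = (if i \<le> r then x i else y (i - r))" for i
  have "(\<Sum>i=1..r+s. z i) = (\<Sum>i=1..r. z i) + (\<Sum>i=r+1..r+s. z i)"
    by (rule sum.ub_add_nat) simp
  also have "(\<Sum>i=r+1..r+s. z i) = (\<Sum>i=1..s. z (i + r))"
    using sum.shift_bounds_cl_nat_ivl[of z 1 r s] by (simp add: add.commute)
  finally have "u + v = (\<Sum>i=1..r+s. z i)"
    by (simp add: z_def x(2) y(2))
  moreover have "z i \<in> affine_cone X" if "i \<in> {1..r+s}" for i
  proof (cases "i \<le> r")
    case False
    with that have "i - r \<in> {1..s}"
      by auto
    with False y(1) show ?thesis
      by (simp add: z_def)
  qed (use that x(1) in \<open>simp add: z_def\<close>)
  ultimately have "X_rank X (u + v) \<le> enat (r + s)"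
    by (intro X_rank_le ballI)
  then show ?thesis
    by (simp add: r s)
qed simp_all

theorem theorem1:
  fixes X :: "('a::alg_closed_field ^ 'n::finite) set set"
    and r_gen :: nat
  assumes "irreducible_proj_variety X"
    and "nondegenerate X"
    and "generic_rank X r_gen"
  shows "max_rank X \<le> 2 * enat r_gen"
proof -
  from assms(3) obtain U where U: "zariski_open U" "U \<noteq> {}"
    and rank: "\<And>u. u \<in> U \<Longrightarrow> X_rank X u = enat r_gen"
    by (auto simp: generic_rank_def)
  have "X_rank X w \<le> 2 * enat r_gen" for w
  proof -
    obtain u where u: "u \<in> U" "w - u \<in> U"
      using infinite_UNIV_alg_closed_field U by (rule zariski_open_meets_reflection)
    \<comment> \<open>Subadditivity applied to \<open>w = u + (w - u)\<close>, where both summands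
      have rank \<open>r_gen\<close>.\<close>
    show ?thesis
      using X_rank_add_le[of X u "w - u"] by (simp add: rank u mult_2)
  qed
  then show ?thesis
    by (auto simp: max_rank_def intro: Sup_least)
qed

end
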